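(* For every integer $k\geq 2$, let $x^k$ denote the unary pattern consisting of the variable $x$ repeated $k$ times. Then $\lambda_\simeq(x^k)=3$ if $k\in\{2,3\}$, and $\lambda_\simeq(x^k)=2$ if $k\geq 4$.
   Context: For a word $u=u_1\cdots u_n$ (letters $u_i$), its reversal is $u^R=u_n\cdots u_1$. Let $\simeq$ be the equivalence relation on words with $u\simeq u'$ iff $u'=u$ or $u'=u^R$. A pattern is a word $p=p_1\cdots p_n$ over an alphabet of variables. A word $w$ encounters $p$ up to $\simeq$ if $w$ has a factor $X_1X_2\cdots X_n$ where each $X_i$ is a nonempty word and $X_i\simeq X_j$ whenever $p_i=p_j$; otherwise $w$ avoids $p$ up to $\simeq$. The pattern $p$ is $k$-avoidable up to $\simeq$ if some infinite word over a $k$-letter alphabet avoids $p$ up to $\simeq$. The avoidability index $\lambda_\simeq(p)$ is the least positive integer $k$ such that $p$ is $k$-avoidable up to $\simeq$ (or $\infty$ if there is none). *)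

theory Defs
  imports Main "HOL-Library.Extended_Nat"
begin

definition rev_equiv :: "'a list \<Rightarrow> 'a list \<Rightarrow> bool"  (infix \<open>\<simeq>\<close> 50) where
  "u \<simeq> u' \<longleftrightarrow> u' = u \<or> u' = rev u"

text \<open>Infinite words are functions on the natural numbers; patterns are lists of variables.\<close>

definition factor_of :: "'a list \<Rightarrow> (nat \<Rightarrow> 'a) \<Rightarrow> bool" where
  "factor_of u w \<longleftrightarrow> (\<exists>i. u = map w [i..<i + length u])"

definition encounters :: "(nat \<Rightarrow> 'a) \<Rightarrow> 'v list \<Rightarrow> bool" where
  "encounters w p \<longleftrightarrow>
     (\<exists>Xs. length Xs = length p
         \<and> (\<forall>i < length p. Xs ! i \<noteq> [])
         \<and> (\<forall>i < length p. \<forall>j < length p. p ! i = p ! j \<longrightarrow> Xs ! i \<simeq> Xs ! j)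
         \<and> factor_of (concat Xs) w)"

definition avoids :: "(nat \<Rightarrow> 'a) \<Rightarrow> 'v list \<Rightarrow> bool" where
  "avoids w p \<longleftrightarrow> \<not> encounters w p"

text \<open>The \<open>k\<close>-letter alphabet is taken to be \<open>{0, \<dots>, k - 1}\<close>.\<close>

definition avoidable :: "nat \<Rightarrow> 'v list \<Rightarrow> bool" where
  "avoidable k p \<longleftrightarrow> (\<exists>w :: nat \<Rightarrow> nat. range w \<subseteq> {..<k} \<and> avoids w p)"

text \<open>The infimum of the empty set in \<^typ>\<open>enat\<close> is \<open>\<infinity>\<close>.\<close>

definition avoidability_index :: "'v list \<Rightarrow> enat" where
  "avoidability_index p = Inf {enat k | k. 0 < k \<and> avoidable k p}"

end

theory Submission
  imports Defs
begin

text \<open>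
  Since \<open>X X\<^sup>R\<close> contains the square of a letter, every square-free word avoids \<open>x x\<close> up to
  reversal, and the differences of the Thue--Morse word form a ternary one. On two letters,
  already 10 letters force a cube up to reversal with blocks of length at most 3. The fourth power
  is avoided by the paperfolding word: it has no square of even period, and neither a square of
  large odd period nor a long palindrome of even length, because a shift or a reflection that
  exchanges odd and even positions does not respect its Toeplitz structure. This leaves only
  blocks of length 1 and 3.
\<close>

section \<open>Unary patterns as runs of consecutive blocks of equal length\<close>

abbreviation block :: "(nat \<Rightarrow> 'a) \<Rightarrow> nat \<Rightarrow> nat \<Rightarrow> 'a list" where
  "block w a p \<equiv> map w [a..<a + p]"

lemma block_append: "block w a p @ block w (a + p) q = block w a (p + q)"
  by (metis add.assoc le_add1 map_append upt_add_eq_append)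

lemma block_eq_iff: "block w a p = block w b p \<longleftrightarrow> (\<forall>i<p. w (a + i) = w (b + i))"
  by (auto simp: list_eq_iff_nth_eq)

lemma block_eq_rev_iff:
  "block w a p = rev (block w b p) \<longleftrightarrow> (\<forall>i<p. w (a + i) = w (b + (p - Suc i)))"
  by (auto simp: list_eq_iff_nth_eq rev_nth)

lemma concat_blocks: "concat (map (\<lambda>i. block w (a + i * p) p) [0..<k]) = block w a (k * p)"
proof (induction k)
  case (Suc k)
  then show ?case
    using block_append[of w a "k * p" p] by (simp add: add.commute)
qed simp

lemma nth_of_concat_eq_block:
  assumes "\<forall>X\<in>set Xs. length X = p" and "concat Xs = block w a (length Xs * p)" and "i < length Xs"
  shows "Xs ! i = block w (a + i * p) p"
  using assms
proof (induction Xs arbitrary: a i)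
  case (Cons X Xs)
  have "X @ concat Xs = block w a p @ block w (a + p) (length Xs * p)"
    using Cons.prems(2) by (simp add: block_append)
  then have X: "X = block w a p" and Xs: "concat Xs = block w (a + p) (length Xs * p)"
    using Cons.prems(1) by simp_all
  show ?case
  proof (cases i)
    case 0
    then show ?thesis using X by simp
  next
    case (Suc j)
    then show ?thesis
      using Cons.IH[of "a + p" j] Xs Cons.prems by (simp add: add.assoc)
  qed
qed simp

text \<open>Reversal preserves length, so all images of the variable share one length
  \<open>p\<close>, and an occurrence is determined by its start \<open>a\<close> and by
  \<open>p\<close>.\<close>

lemma encounters_replicate_iff:
  "encounters w (replicate k x) \<longleftrightarrow>
     (\<exists>a p. p > 0 \<and> (\<forall>i<k. \<forall>j<k. block w (a + i * p) p \<simeq> block w (a + j * p) p))"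
    (is "?L \<longleftrightarrow> ?R")
proof
  assume ?L
  then obtain Xs a where len: "length Xs = k" and ne: "\<forall>i<k. Xs ! i \<noteq> []"
    and eqv: "\<forall>i<k. \<forall>j<k. Xs ! i \<simeq> Xs ! j"
    and a: "concat Xs = block w a (length (concat Xs))"
    by (auto simp: encounters_def factor_of_def)
  show ?R
  proof (cases "k = 0")
    case False
    define p where "p = length (Xs ! 0)"
    have *: "length (Xs ! i) = p" if "i < k" for i
    proof -
      have "Xs ! 0 \<simeq> Xs ! i" using eqv that False by simp
      then show ?thesis by (auto simp: rev_equiv_def p_def)
    qed
    then have all: "\<forall>X\<in>set Xs. length X = p"
      using len by (metis in_set_conv_nth)
    have "map length Xs = replicate k p"
      by (rule nth_equalityI) (use len * in auto)
    then have "length (concat Xs) = k * p"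
      by (simp add: length_concat sum_list_replicate)
    then have "Xs ! i = block w (a + i * p) p" if "i < k" for i
      using nth_of_concat_eq_block[OF all, of w a i] a len that by simp
    moreover have "p > 0" using ne False by (simp add: p_def)
    ultimately show ?thesis using eqv by auto
  qed auto
next
  assume ?R
  then obtain a p where p: "p > 0"
    and eqv: "\<forall>i<k. \<forall>j<k. block w (a + i * p) p \<simeq> block w (a + j * p) p" by blast
  let ?Xs = "map (\<lambda>i. block w (a + i * p) p) [0..<k]"
  have "factor_of (concat ?Xs) w"
    unfolding factor_of_def concat_blocks by (intro exI[of _ a]) simp
  then show ?L
    unfolding encounters_def using p eqv by (intro exI[of _ ?Xs]) auto
qed

lemma avoids_replicate_mono:
  assumes "avoids w (replicate k x)" and "k \<le> l"
  shows "avoids w (replicate l x)"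
  using assms unfolding avoids_def encounters_replicate_iff by (meson less_le_trans)

lemma avoidable_replicate_mono:
  assumes "avoidable m (replicate k x)" and "k \<le> l" and "m \<le> n"
  shows "avoidable n (replicate l x)"
  using assms avoids_replicate_mono unfolding avoidable_def
  by (metis lessThan_subset_iff subset_trans)


section \<open>Relabelling of letters\<close>

lemma rev_equiv_map_inj: "inj f \<Longrightarrow> map f u \<simeq> map f v \<longleftrightarrow> u \<simeq> v"
  by (simp add: rev_equiv_def rev_map inj_map_eq_map)

lemma avoids_replicate_comp_inj:
  assumes "inj f"
  shows "avoids (f \<circ> w) (replicate k x) \<longleftrightarrow> avoids w (replicate k x)"
  unfolding avoids_def encounters_replicate_iff map_map[symmetric] rev_equiv_map_inj[OF assms] ..

text \<open>With Boolean letters, constraints on finitely many positions of a binary word become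
  propositional formulas.\<close>

lemma avoidable_2_replicate_iff:
  "avoidable 2 (replicate k x) \<longleftrightarrow> (\<exists>b :: nat \<Rightarrow> bool. avoids b (replicate k x))" (is "?L \<longleftrightarrow> ?R")
proof
  let ?f = "of_bool :: bool \<Rightarrow> nat"
  have inj: "inj ?f" by (simp add: inj_def)
  { assume ?L
    then obtain w :: "nat \<Rightarrow> nat" where ran: "range w \<subseteq> {..<2}" and av: "avoids w (replicate k x)"
      by (auto simp: avoidable_def)
    have "w i = ?f (w i = 1)" for i
      using ran by (cases "w i = 1") (auto simp: subset_iff less_2_cases_iff)
    then have "w = ?f \<circ> (\<lambda>i. w i = 1)" by auto
    then show ?R using av avoids_replicate_comp_inj[OF inj] by metis }
  { assume ?R
    then obtain b :: "nat \<Rightarrow> bool" where "avoids (?f \<circ> b) (replicate k x)"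
      using avoids_replicate_comp_inj[OF inj] by metis
    moreover have "range (?f \<circ> b) \<subseteq> {..<2}" by auto
    ultimately show ?L unfolding avoidable_def by blast }
qed


section \<open>Binary words and the cube\<close>

lemma not_avoidable_2_cube: "\<not> avoidable 2 (replicate 3 x)"
proof
  assume "avoidable 2 (replicate 3 x)"
  then obtain w :: "nat \<Rightarrow> bool" where av: "avoids w (replicate 3 x)"
    unfolding avoidable_2_replicate_iff by blast
  have less3: "(\<forall>i<3. P i) \<longleftrightarrow> P 0 \<and> P 1 \<and> P 2" for P :: "nat \<Rightarrow> bool"
    by (auto simp: numeral_3_eq_3 less_Suc_eq numeral_2_eq_2)
  have av: "\<not> (block w a p \<simeq> block w (a + p) p \<and> block w a p \<simeq> block w (a + 2 * p) p)"
    if "p > 0" for a p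
  proof
    assume "block w a p \<simeq> block w (a + p) p \<and> block w a p \<simeq> block w (a + 2 * p) p"
    then have "\<forall>i<3. \<forall>j<3. block w (a + i * p) p \<simeq> block w (a + j * p) p"
      unfolding less3 rev_equiv_def by auto
    then show False
      using av that unfolding avoids_def encounters_replicate_iff by blast
  qed
  \<comment> \<open>These instances are all placements of three blocks of length 1, 2 or 3 within
    the ten letters \<open>w 0\<close> to \<open>w 9\<close>. Together they are propositionally
    unsatisfiable.\<close>
  show False
    using av[of 1 0] av[of 1 1] av[of 1 2] av[of 1 3] av[of 1 4] av[of 1 5] av[of 1 6] av[of 1 7]
      av[of 2 0] av[of 2 1] av[of 2 2] av[of 2 3] av[of 2 4] av[of 3 0] av[of 3 1]
    by (simp add: rev_equiv_def numeral_eq_Suc) argo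
qed


section \<open>The ternary Thue word\<close>

text \<open>The value is the parity of the number of ones in the binary expansion of
  \<open>n\<close>.\<close>

fun thue_morse :: "nat \<Rightarrow> bool" where
  "thue_morse n = (if n = 0 then False else thue_morse (n div 2) \<noteq> odd n)"

declare thue_morse.simps[simp del]

lemma thue_morse_double: "thue_morse (2 * n) = thue_morse n"
  by (subst thue_morse.simps) (auto simp: thue_morse.simps[of 0])

lemma thue_morse_Suc_double: "thue_morse (Suc (2 * n)) \<longleftrightarrow> \<not> thue_morse n"
  by (subst thue_morse.simps) auto

lemma thue_morse_even_Suc:
  assumes "even n" shows "thue_morse (Suc n) \<longleftrightarrow> \<not> thue_morse n"
  using assms by (auto elim!: evenE simp: thue_morse_double thue_morse_Suc_double)

text \<open>By induction on the period: an even period is halved by sampling every second position,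
  and an odd period forces the word to alternate.\<close>

lemma thue_morse_overlap_free:
  assumes "p > 0" shows "\<exists>i\<le>p. thue_morse (a + i) \<noteq> thue_morse (a + i + p)"
  using assms
proof (induction p arbitrary: a rule: less_induct)
  case (less p)
  show ?case
  proof (rule ccontr)
    assume "\<not> ?thesis"
    then have eq: "thue_morse (a + i) = thue_morse (a + i + p)" if "i \<le> p" for i
      using that by blast
    show False
    proof (cases "even p")
      case True
      then obtain q where q: "p = 2 * q" by (elim evenE)
      \<comment> \<open>The positions \<open>a + 2 * i\<close> have the same parity as
        \<open>a\<close>, so halving them keeps all letters or negates all of them.\<close>
      have "thue_morse (a div 2 + i) = thue_morse (a div 2 + i + q)" if "i \<le> q" for i
      proof (cases "even a")
        case True
        then obtain b where "a = 2 * b" by (elim evenE)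
        then show ?thesis
          using eq[of "2 * i"] that q thue_morse_double[of "b + i"] thue_morse_double[of "b + i + q"]
          by simp
      next
        case False
        then obtain b where "a = Suc (2 * b)" by (metis oddE Suc_eq_plus1)
        then show ?thesis
          using eq[of "2 * i"] that q
            thue_morse_Suc_double[of "b + i"] thue_morse_Suc_double[of "b + i + q"]
          by simp
      qed
      moreover have "q < p" "q > 0" using q less.prems by auto
      ultimately show False using less.IH by blast
    next
      case False
      \<comment> \<open>One of \<open>a + i\<close> and \<open>a + i + p\<close> is even, so the word alternates on the whole period.\<close>
      have alt: "thue_morse (Suc (a + i)) \<longleftrightarrow> \<not> thue_morse (a + i)" if "i < p" for i
        using thue_morse_even_Suc[of "a + i"] thue_morse_even_Suc[of "a + i + p"]
          eq[of i] eq[of "Suc i"] that False by auto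
      have "thue_morse (a + i) \<longleftrightarrow> (thue_morse a \<longleftrightarrow> even i)" if "i \<le> p" for i
        using that by (induction i) (auto simp: alt)
      \<comment> \<open>Alternation over the odd distance \<open>p\<close> gives different letters
        at \<open>a\<close> and \<open>a + p\<close>.\<close>
      from this[of p] eq[of 0] show False using False by simp
    qed
  qed
qed

text \<open>The differences are shifted by 1 to lie in {0, 1, 2}; adding before subtracting avoids
  truncation at 0.\<close>

definition thue_word :: "nat \<Rightarrow> nat" where
  "thue_word n = 1 + of_bool (thue_morse (Suc n)) - of_bool (thue_morse n)"

text \<open>Summing the differences turns a square into a Thue-Morse overlap, as \<open>p\<close>
  differences span \<open>p + 1\<close> letters.\<close>

lemma thue_word_square_free:
  assumes "p > 0" shows "block thue_word a p \<noteq> block thue_word (a + p) p"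
proof
  define t :: "nat \<Rightarrow> int" where "t n = of_bool (thue_morse n)" for n
  have thue: "int (thue_word n) = 1 + t (Suc n) - t n" for n
    by (auto simp: thue_word_def t_def)
  assume "block thue_word a p = block thue_word (a + p) p"
  then have eq: "thue_word (a + i) = thue_word (a + i + p)" if "i < p" for i
    using that unfolding block_eq_iff by (metis add.assoc add.commute)
  have step: "t (Suc (a + i + p)) - t (a + i + p) = t (Suc (a + i)) - t (a + i)" if "i < p" for i
    using thue[of "a + i"] thue[of "a + i + p"] eq[OF that] by simp
  have shift: "t (a + i + p) - t (a + i) = t (a + p) - t a" if "i \<le> p" for i
    using that
  proof (induction i)
    case (Suc i)
    then show ?case using step[of i] by simp
  qed simp
  \<comment> \<open>The increment \<open>t (a + p) - t a\<close> occurs twice in a row, but \<open>t\<close> takes only the values 0 and 1.\<close>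
  have "t (a + p) = t a"
    using shift[of p] by (simp add: t_def of_bool_def split: if_splits)
  then have "\<forall>i\<le>p. thue_morse (a + i) = thue_morse (a + i + p)"
    using shift by (simp add: t_def of_bool_eq_iff)
  then show False using thue_morse_overlap_free[OF assms] by blast
qed

lemma avoidable_3_square: "avoidable 3 (replicate 2 x)"
proof -
  have "\<not> block thue_word a p \<simeq> block thue_word (a + p) p" if "p > 0" for a p
  proof
    assume "block thue_word a p \<simeq> block thue_word (a + p) p"
    then consider "block thue_word a p = block thue_word (a + p) p"
      | "block thue_word (a + p) p = rev (block thue_word a p)"
      by (auto simp: rev_equiv_def)
    then show False
    proof cases
      case 1
      then show False using thue_word_square_free that by blast
    next
      case 2
      \<comment> \<open>The last letter of the first block meets the first letter of its
        reversal.\<close>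
      then have "thue_word (a + p - 1) = thue_word (a + p)"
        using that unfolding block_eq_rev_iff by force
      then have "block thue_word (a + p - 1) 1 = block thue_word (a + p - 1 + 1) 1"
        unfolding block_eq_iff using that by simp
      then show False using thue_word_square_free[OF zero_less_one] by blast
    qed
  qed
  then have "avoids thue_word (replicate 2 x)"
    unfolding avoids_def encounters_replicate_iff
    by (metis add.right_neutral mult_0 mult_1 one_less_numeral_iff pos2 semiring_norm(76))
  moreover have "range thue_word \<subseteq> {..<3}"
    by (auto simp: thue_word_def)
  ultimately show ?thesis by (auto simp: avoidable_def)
qed


section \<open>The paperfolding word\<close>

text \<open>For positive \<open>n\<close>, the letter records whether the odd part of
  \<open>n\<close> is 3 modulo 4. The value at 0 is a default compatible with doubling.\<close>

fun paperfolding :: "nat \<Rightarrow> bool" where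
  "paperfolding n = (if n = 0 then False else if odd n then n mod 4 = 3 else paperfolding (n div 2))"

declare paperfolding.simps[simp del]

lemma paperfolding_odd: "odd n \<Longrightarrow> paperfolding n \<longleftrightarrow> n mod 4 = 3"
  by (subst paperfolding.simps) auto

lemma paperfolding_double: "paperfolding (2 * n) = paperfolding n"
  by (subst paperfolding.simps) (auto simp: paperfolding.simps[of 0])

lemma paperfolding_add_2:
  assumes "odd n" shows "paperfolding (n + 2) \<longleftrightarrow> \<not> paperfolding n"
proof -
  have "(n + 2) mod 4 = 3 \<longleftrightarrow> n mod 4 \<noteq> 3" using assms by presburger
  then show ?thesis using assms by (simp add: paperfolding_odd)
qed

lemma paperfolding_add_4:
  assumes "n mod 4 = 2" shows "paperfolding (n + 4) \<longleftrightarrow> \<not> paperfolding n"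
proof -
  obtain m where m: "n = 2 * m" "odd m"
    by (rule that[of "n div 2"]) (use assms in presburger)+
  then have "paperfolding (2 * (m + 2)) \<longleftrightarrow> \<not> paperfolding (2 * m)"
    unfolding paperfolding_double by (intro paperfolding_add_2)
  then show ?thesis by (simp add: m numeral_eq_Suc)
qed

text \<open>An odd position determines its residue modulo 4, so the period is a multiple of 4.
  Halving the even positions then gives a square of half the period, which is still even.\<close>

lemma paperfolding_no_even_square:
  assumes "even p" "p > 0" shows "block paperfolding a p \<noteq> block paperfolding (a + p) p"
  using assms
proof (induction p arbitrary: a rule: less_induct)
  case (less p)
  obtain q where q: "p = 2 * q" using less.prems by (elim evenE)
  show ?case
  proof
    assume "block paperfolding a p = block paperfolding (a + p) p"
    then have eq: "paperfolding (a + i) = paperfolding (a + p + i)" if "i < p" for i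
      using that by (simp add: block_eq_iff)
    obtain i where i: "i < 2" "odd (a + i)"
      by (metis add.right_neutral even_add odd_one one_less_numeral_iff pos2 semiring_norm(76))
    then have "(a + i) mod 4 = 3 \<longleftrightarrow> (a + p + i) mod 4 = 3"
      using eq[of i] less.prems q by (simp add: paperfolding_odd)
    with i have "even q" using q by presburger
    \<comment> \<open>Rounding up makes \<open>2 * ?b\<close> the first even position from
      \<open>a\<close> on.\<close>
    let ?b = "(a + 1) div 2"
    have "paperfolding (?b + j) = paperfolding (?b + q + j)" if "j < q" for j
    proof -
      define i where "i = 2 * (?b + j) - a"
      have i: "a + i = 2 * (?b + j)" "i < p" using that q by (auto simp: i_def)
      then have "a + p + i = 2 * (?b + q + j)" using q by simp
      then show ?thesis
        using eq[OF i(2)] i(1) by (simp only: paperfolding_double)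
    qed
    moreover have "q < p" "q > 0" using q less.prems by auto
    ultimately show False
      using less.IH[of q ?b] \<open>even q\<close> by (simp add: block_eq_iff)
  qed
qed

lemma ex_less_4_add_mod_4_eq_2: "\<exists>i<4. (n + i) mod 4 = (2::nat)"
proof -
  consider "n mod 4 = 0" | "n mod 4 = 1" | "n mod 4 = 2" | "n mod 4 = 3" by linarith
  then show ?thesis
    by cases (rule exI[of _ 2] exI[of _ 1] exI[of _ 0] exI[of _ 3]; simp add: mod_simps; presburger)+
qed

text \<open>At odd positions the word has period 4, whereas at the positions congruent to 2 modulo 4 a
  shift by 4 flips the letter. A shift or reflection exchanging the two parities is therefore
  incompatible with the word as soon as it acts on 8 consecutive positions.\<close>

lemma paperfolding_no_long_odd_period:
  assumes "odd p" "n \<ge> 8" shows "block paperfolding a n \<noteq> block paperfolding (a + p) n"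
proof
  assume "block paperfolding a n = block paperfolding (a + p) n"
  then have eq: "paperfolding (a + i) = paperfolding (a + p + i)" if "i < 8" for i
    using that assms(2) by (simp add: block_eq_iff)
  \<comment> \<open>Both \<open>i\<close> and \<open>i + 4\<close> lie in the window of 8, so the
    flip on the shifted side can be compared with the unchanged letter on the other side.\<close>
  obtain i where i: "i < 4" "(a + p + i) mod 4 = 2"
    using ex_less_4_add_mod_4_eq_2 by blast
  then have "odd (a + i)" using assms(1) by presburger
  then have "paperfolding (a + i) = paperfolding (a + (i + 4))"
    by (simp add: paperfolding_odd mod_simps flip: add.assoc)
  moreover have "paperfolding (a + p + i) \<noteq> paperfolding (a + p + (i + 4))"
    using paperfolding_add_4[OF i(2)] by (simp add: add.assoc)
  ultimately show False using eq[of i] eq[of "i + 4"] i(1) by simp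
qed

lemma paperfolding_no_long_even_palindrome:
  assumes "p \<ge> 4" shows "block paperfolding (a + p) p \<noteq> rev (block paperfolding a p)"
proof
  assume *: "block paperfolding (a + p) p = rev (block paperfolding a p)"
  \<comment> \<open>\<open>?c\<close> is the last position of the palindrome, and
    \<open>?c - i\<close> mirrors \<open>a + i\<close>.\<close>
  let ?c = "a + 2 * p - 1"
  have sym: "paperfolding (a + i) = paperfolding (?c - i)" if "i < 2 * p" for i
  proof (cases "i < p")
    case True
    have "block paperfolding a p = rev (block paperfolding (a + p) p)" using * by simp
    then have "paperfolding (a + i) = paperfolding (a + p + (p - Suc i))"
      using True unfolding block_eq_rev_iff by blast
    moreover have "a + p + (p - Suc i) = ?c - i" using True by simp
    ultimately show ?thesis by simp
  next
    case False
    then have "i - p < p" using that by simp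
    then have "paperfolding (a + p + (i - p)) = paperfolding (a + (p - Suc (i - p)))"
      using * unfolding block_eq_rev_iff by blast
    moreover have "a + p + (i - p) = a + i" "a + (p - Suc (i - p)) = ?c - i"
      using False that by auto
    ultimately show ?thesis by metis
  qed
  \<comment> \<open>The last eight positions start at \<open>?d\<close>. Two of them,
    \<open>?d + u\<close> and \<open>?d + u + 4\<close>, carry a flip; their mirror images are odd
    positions at distance 4, hence with equal letters.\<close>
  let ?d = "a + 2 * p - 8"
  obtain u where u: "u < 4" "(?d + u) mod 4 = 2"
    using ex_less_4_add_mod_4_eq_2 by blast
  have mirror: "?c - (3 - u) = ?d + u + 4" "?c - (3 - u + 4) = ?d + u" and odd_sum: "odd (a + (3 - u) + (?d + u))"
  proof -
    obtain m where m: "p = m + 4" using assms by (metis add.commute le_Suc_ex)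
    show "?c - (3 - u) = ?d + u + 4" "?c - (3 - u + 4) = ?d + u" using u(1) m by auto
    have "a + (3 - u) + (?d + u) = 2 * (a + m) + 3" using u(1) m by auto
    then show "odd (a + (3 - u) + (?d + u))" by presburger
  qed
  have "even n" if "n mod 4 = 2" for n :: nat
    using that by presburger
  then have "even (?d + u)" using u(2) by blast
  with odd_sum have "odd (a + (3 - u))" by simp
  then have "paperfolding (a + (3 - u)) = paperfolding (a + (3 - u + 4))"
    by (simp add: paperfolding_odd mod_simps flip: add.assoc)
  moreover have "paperfolding (?d + u) \<noteq> paperfolding (?d + u + 4)"
    using paperfolding_add_4[OF u(2)] by simp
  ultimately show False
    using sym[of "3 - u"] sym[of "3 - u + 4"] assms unfolding mirror by simp
qed

lemma avoidable_2_fourth_power: "avoidable 2 (replicate 4 x)"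
proof -
  let ?B = "block paperfolding"
  have "\<not> (?B a p \<simeq> ?B (a + p) p \<and> ?B a p \<simeq> ?B (a + 2 * p) p \<and> ?B a p \<simeq> ?B (a + 3 * p) p)"
    (is "\<not> ?E") if "p > 0" for a p
  proof
    assume E: ?E
    have a: "a + p + p = a + 2 * p" "a + 2 * p + p = a + 3 * p" by simp_all
    have "even p \<or> odd p \<and> p \<ge> 5 \<or> p = 1 \<or> p = 3"
      using \<open>p > 0\<close> by presburger
    then consider "even p" | "odd p" "p \<ge> 5" | "p = 1" | "p = 3" by blast
    then show False
    proof cases
      case 1
      \<comment> \<open>Adjacent blocks differ, so the blocks alternate and form a square of the even period \<open>2 * p\<close>.\<close>
      have "?B a p \<noteq> ?B (a + p) p" "?B (a + p) p \<noteq> ?B (a + 2 * p) p" "?B (a + 2 * p) p \<noteq> ?B (a + 3 * p) p"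
        using paperfolding_no_even_square[OF 1 that] a by metis+
      with E have "?B a p = ?B (a + 2 * p) p" "?B (a + p) p = ?B (a + 3 * p) p"
        unfolding rev_equiv_def by metis+
      then have "?B a (2 * p) = ?B (a + 2 * p) (2 * p)"
        using block_append[of paperfolding a p p] block_append[of paperfolding "a + 2 * p" p p] a
        by (metis mult_2)
      then show False using paperfolding_no_even_square[of "2 * p" a] that by simp
    next
      case 2
      \<comment> \<open>No two adjacent blocks are mirror images, so the first three coincide and
        give the odd period \<open>p\<close> over \<open>2 * p\<close> positions.\<close>
      have "p \<ge> 4" using 2 by simp
      then have "?B (a + p) p \<noteq> rev (?B a p)" "?B (a + 2 * p) p \<noteq> rev (?B (a + p) p)"
          "?B (a + 3 * p) p \<noteq> rev (?B (a + 2 * p) p)"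
        using paperfolding_no_long_even_palindrome[of p] a by metis+
      with E have "?B a p = ?B (a + p) p" "?B (a + p) p = ?B (a + 2 * p) p"
        unfolding rev_equiv_def by metis+
      then have "?B a (2 * p) = ?B (a + p) (2 * p)"
        using block_append[of paperfolding a p p] block_append[of paperfolding "a + p" p p] a
        by (metis mult_2)
      then show False using paperfolding_no_long_odd_period[of p "2 * p" a] 2 by simp
    next
      case 3
      then have "paperfolding (a + i) = paperfolding a" if "i < 4" for i
        using E that by (auto simp: rev_equiv_def numeral_eq_Suc less_Suc_eq)
      from this[of 1] this[of 2] this[of 3]
      have "paperfolding (a + 2) = paperfolding a" "paperfolding (a + 1 + 2) = paperfolding (a + 1)"
        by (simp_all add: numeral_eq_Suc)
      \<comment> \<open>One of \<open>a\<close> and \<open>a + 1\<close> is odd, and from there the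
        letter two places on is flipped.\<close>
      then show False using paperfolding_add_2[of a] paperfolding_add_2[of "a + 1"] by auto
    next
      case 4
      let ?f = "\<lambda>i. paperfolding (a + i)"
      \<comment> \<open>Reversing a block of length 3 swaps the outer letters, so all four blocks
        share their middle letter.\<close>
      have B1: "?f 3 = ?f 0 \<and> ?f 4 = ?f 1 \<and> ?f 5 = ?f 2 \<or> ?f 3 = ?f 2 \<and> ?f 4 = ?f 1 \<and> ?f 5 = ?f 0"
        and B2: "?f 6 = ?f 0 \<and> ?f 7 = ?f 1 \<and> ?f 8 = ?f 2 \<or> ?f 6 = ?f 2 \<and> ?f 7 = ?f 1 \<and> ?f 8 = ?f 0"
        and B3: "?f 9 = ?f 0 \<and> ?f 10 = ?f 1 \<and> ?f 11 = ?f 2 \<or> ?f 9 = ?f 2 \<and> ?f 10 = ?f 1 \<and> ?f 11 = ?f 0"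
        using E unfolding 4 by (simp_all add: rev_equiv_def numeral_eq_Suc)
      have A2: "?f j \<longleftrightarrow> \<not> ?f i" if "odd (a + i)" "j = i + 2" for i j
        using paperfolding_add_2[OF that(1)] that(2) by (simp add: add.assoc)
      have A4: "?f j \<longleftrightarrow> \<not> ?f i" if "(a + i) mod 4 = 2" "j = i + 4" for i j
        using paperfolding_add_4[OF that(1)] that(2) by (simp add: add.assoc)
      \<comment> \<open>The residue of \<open>a\<close> determines which of the twelve positions are
        odd or 2 modulo 4. The flips there contradict the block relations.\<close>
      consider "a mod 4 = 1" | "a mod 4 = 3" | "a mod 4 = 2" | "a mod 4 = 0" by linarith
      then show False
      proof cases
        case 1
        then have "odd (a + 0)" "odd (a + 2)" "odd (a + 4)" "odd (a + 6)" "odd (a + 8)"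
          "(a + 1) mod 4 = 2" "(a + 5) mod 4 = 2" by presburger+
        then show False
          using B1 B2 B3 A2[of 0 2] A2[of 2 4] A2[of 4 6] A2[of 6 8] A2[of 8 10] A4[of 1 5] A4[of 5 9]
          by (simp; argo?)
      next
        case 2
        then have "odd (a + 0)" "odd (a + 2)" "odd (a + 4)" "odd (a + 6)" "odd (a + 8)"
          "(a + 3) mod 4 = 2" "(a + 7) mod 4 = 2" by presburger+
        then show False
          using B1 B2 B3 A2[of 0 2] A2[of 2 4] A2[of 4 6] A2[of 6 8] A2[of 8 10] A4[of 3 7] A4[of 7 11]
          by (simp; argo?)
      next
        case 3
        then have "odd (a + 1)" "odd (a + 3)" "odd (a + 5)" "odd (a + 7)" "odd (a + 9)"
          "(a + 0) mod 4 = 2" "(a + 4) mod 4 = 2" by presburger+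
        then show False
          using B1 B2 B3 A2[of 1 3] A2[of 3 5] A2[of 5 7] A2[of 7 9] A2[of 9 11] A4[of 0 4] A4[of 4 8]
          by (simp; argo?)
      next
        case 4
        then have "odd (a + 1)" "odd (a + 3)" "odd (a + 5)" "odd (a + 7)" "odd (a + 9)"
          "(a + 2) mod 4 = 2" "(a + 6) mod 4 = 2" by presburger+
        then show False
          using B1 B2 B3 A2[of 1 3] A2[of 3 5] A2[of 5 7] A2[of 7 9] A2[of 9 11] A4[of 2 6] A4[of 6 10]
          by (simp; argo?)
      qed
    qed
  qed
  then have "avoids paperfolding (replicate 4 x)"
    unfolding avoids_def encounters_replicate_iff
    by (metis add.right_neutral mult_0 mult_1 zero_less_numeral one_less_numeral_iff numeral_less_iff semiring_norm(76) semiring_norm(78) semiring_norm(81))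
  then show ?thesis
    unfolding avoidable_2_replicate_iff by blast
qed

section \<open>The avoidability index of unary patterns\<close>

theorem theorem3:
  fixes k :: nat and x :: 'v
  assumes "k \<ge> 2"
  shows "(k \<in> {2, 3} \<longrightarrow> avoidability_index (replicate k x) = 3)
       \<and> (k \<ge> 4 \<longrightarrow> avoidability_index (replicate k x) = 2)"
proof -
  \<comment> \<open>Enlarging the alphabet preserves avoidability, so failure at
    \<open>n - 1\<close> excludes every smaller alphabet.\<close>
  have index: "avoidability_index (replicate k x) = enat n"
    if "avoidable n (replicate k x)" "\<not> avoidable (n - 1) (replicate k x)" "n > 0" for n
  proof -
    have "n \<le> m" if "avoidable m (replicate k x)" for m
      using avoidable_replicate_mono[OF that, of k "n - 1"] \<open>\<not> avoidable (n - 1) (replicate k x)\<close>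
      by linarith
    then show ?thesis
      unfolding avoidability_index_def using that by (intro Inf_eqI) auto
  qed
  show ?thesis
  proof (intro conjI impI)
    assume "k \<in> {2, 3}"
    \<comment> \<open>Avoidability passes from lower to higher powers: the square gives the upper
      bound, the cube the lower one.\<close>
    then have "avoidable 3 (replicate k x)" "\<not> avoidable 2 (replicate k x)"
      using avoidable_replicate_mono[OF avoidable_3_square[of x], of k 3]
        avoidable_replicate_mono[of 2 k x 3 2] not_avoidable_2_cube[of x] by auto
    then show "avoidability_index (replicate k x) = 3"
      using index[of 3] by (simp add: numeral_eq_enat)
  next
    assume "k \<ge> 4"
    then have "avoidable 2 (replicate k x)"
      using avoidable_replicate_mono[OF avoidable_2_fourth_power[of x]] by blast
    \<comment> \<open>The only word over one letter is constant and contains every power of that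
      letter.\<close>
    moreover have "\<not> avoidable 1 (replicate k x)"
    proof
      assume "avoidable 1 (replicate k x)"
      then obtain w :: "nat \<Rightarrow> nat" where "range w \<subseteq> {..<1}" and av: "avoids w (replicate k x)"
        by (auto simp: avoidable_def)
      then have "w = (\<lambda>_. 0)" by (auto simp: fun_eq_iff subset_iff)
      then have "encounters w (replicate k x)"
        unfolding encounters_replicate_iff
        by (intro exI[of _ 0] exI[of _ 1]) (simp add: rev_equiv_def)
      then show False using av by (simp add: avoids_def)
    qed
    ultimately show "avoidability_index (replicate k x) = 2"
      using index[of 2] by (simp add: numeral_eq_enat)
  qed
qed

end
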